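(* Let $H$ be an upper entropy function. Then for every integer $N\ge 1$, every $(p_1,\dots,p_N)\in\Omega_N$ and every $n\in\{1,\dots,N\}$, $$H(p_1,\dots,p_{n-1},p_n,\dots,p_N)=H(p_1,\dots,p_{n-1},0,p_n,\dots,p_N).$$
   Context: For each integer $N\ge 1$ let $\Omega_N=\{(p_1,\dots,p_N): p_i\ge 0,\ \sum_{i=1}^N p_i=1\}$, and let $\Omega=\bigcup_{N\ge1}\Omega_N$. A function $H:\Omega\to\mathbb{R}$ is called an upper entropy function if it satisfies: (i) Continuity: the restriction of $H$ to each $\Omega_N$ is continuous, and $H(p_1,\dots,p_N)=0$ if and only if there is $k$ with $p_k=1$. (ii) Symmetry: $H(p_1,\dots,p_N)$ is invariant under permutations of its arguments. (iii) Increasing property: if $(p_1,\dots,p_N)\in\Omega_N$, $1\le n\le N$, $m\ge1$, $q_1,\dots,q_m\ge 0$ and $p_n=\sum_{i=1}^m q_i$, then $$0\le H(p_1,\dots,p_{n-1},q_1,\dots,q_m,p_{n+1},\dots,p_N)-H(p_1,\dots,p_N)\le p_n H\Big(\frac{q_1}{p_n},\dots,\frac{q_m}{p_n}\Big),$$ where the right-hand side is read as $0$ when $p_n=0$. (iv) Maximum: for every $N\ge1$ and $(p_1,\dots,p_N)\in\Omega_N$, $H(p_1,\dots,p_N)\le H(\frac1N,\dots,\frac1N)$. *)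

theory Defs
  imports "HOL-Analysis.Analysis" "HOL-Combinatorics.Permutations"
begin

text \<open>
  A point of \<open>\<Omega>\<^sub>N\<close> is a list of length \<open>N\<close>, so that a function on the union of all \<open>\<Omega>\<^sub>N\<close>
  is a function on lists of which only the values on that union matter. List positions count
  from \<open>0\<close>: the entry \<open>p\<^sub>n\<close>, for \<open>n\<close> from \<open>1\<close> to \<open>N\<close>, is \<open>p ! (n - 1)\<close>.
\<close>

definition Omega :: "nat \<Rightarrow> real list set" where
  "Omega N = {p. length p = N \<and> (\<forall>x\<in>set p. 0 \<le> x) \<and> sum_list p = 1}"

text \<open>
  The library has no topology on lists; continuity on \<open>\<Omega>\<^sub>N\<close> is expressed by identifying
  a list of length \<open>N\<close> with a point of the product space of \<open>N\<close> copies of the real line.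
\<close>

definition continuous_on_Omega :: "nat \<Rightarrow> (real list \<Rightarrow> real) \<Rightarrow> bool" where
  "continuous_on_Omega N H \<longleftrightarrow>
     continuous_map (subtopology (powertop_real {..<N}) {x. map x [0..<N] \<in> Omega N})
       euclideanreal (\<lambda>x. H (map x [0..<N]))"

definition entropy_continuity :: "(real list \<Rightarrow> real) \<Rightarrow> bool" where
  "entropy_continuity H \<longleftrightarrow>
     (\<forall>N\<ge>1. continuous_on_Omega N H \<and>
        (\<forall>p\<in>Omega N. H p = 0 \<longleftrightarrow> (\<exists>k<N. p ! k = 1)))"

definition entropy_symmetry :: "(real list \<Rightarrow> real) \<Rightarrow> bool" where
  "entropy_symmetry H \<longleftrightarrow>
     (\<forall>N\<ge>1. \<forall>p\<in>Omega N. \<forall>\<pi>. \<pi> permutes {..<N} \<longrightarrow> H (permute_list \<pi> p) = H p)"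

definition entropy_increasing :: "(real list \<Rightarrow> real) \<Rightarrow> bool" where
  "entropy_increasing H \<longleftrightarrow>
     (\<forall>N\<ge>1. \<forall>p\<in>Omega N. \<forall>n<N. \<forall>m\<ge>1. \<forall>q.
        length q = m \<and> (\<forall>x\<in>set q. 0 \<le> x) \<and> p ! n = sum_list q \<longrightarrow>
        0 \<le> H (take n p @ q @ drop (Suc n) p) - H p \<and>
        H (take n p @ q @ drop (Suc n) p) - H p
          \<le> (if p ! n = 0 then 0 else p ! n * H (map (\<lambda>x. x / p ! n) q)))"

definition entropy_maximum :: "(real list \<Rightarrow> real) \<Rightarrow> bool" where
  "entropy_maximum H \<longleftrightarrow>
     (\<forall>N\<ge>1. \<forall>p\<in>Omega N. H p \<le> H (replicate N (1 / real N)))"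

definition upper_entropy :: "(real list \<Rightarrow> real) \<Rightarrow> bool" where
  "upper_entropy H \<longleftrightarrow>
     entropy_continuity H \<and> entropy_symmetry H \<and> entropy_increasing H \<and> entropy_maximum H"

end

theory Submission
  imports Defs
begin

text \<open>
  Inserting a zero in front of \<open>p\<^sub>n\<close> is the same as splitting the entry \<open>p\<^sub>n\<close> into the two
  entries \<open>0\<close> and \<open>p\<^sub>n\<close>. By the increasing property such a split changes \<open>H\<close> by at least
  \<open>0\<close> and at most \<open>p\<^sub>n H(0, 1)\<close>, the weights relative to \<open>p\<^sub>n\<close> being \<open>0\<close> and \<open>1\<close>.
  But \<open>(0, 1)\<close> is a degenerate distribution, so \<open>H(0, 1) = 0\<close> and nothing changes; when
  \<open>p\<^sub>n = 0\<close> the upper bound is \<open>0\<close> by convention.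
\<close>

theorem mainTheorem1:
  fixes H :: "real list \<Rightarrow> real" and p :: "real list" and N n :: nat
  assumes "upper_entropy H"
    and "N \<ge> 1"
    and "p \<in> Omega N"
    and "n \<in> {1..N}"
  shows "H p = H (take (n - 1) p @ [0] @ drop (n - 1) p)"
proof -
  define k where "k = n - 1"
  have k: "k < N" and len: "length p = N" and nonneg: "0 \<le> p ! k"
    using assms(3,4) by (auto simp: k_def Omega_def)
  let ?split = "take k p @ [0, p ! k] @ drop (Suc k) p"
  have split_eq: "?split = take k p @ [0] @ drop k p"
    using k len by (simp add: Cons_nth_drop_Suc)
  have "[0, 1] \<in> Omega 2"
    by (simp add: Omega_def)
  moreover have "\<exists>j<2. [0, 1 :: real] ! j = 1"
    by (rule exI[of _ 1]) simp
  ultimately have H01: "H [0, 1] = 0"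
    using assms(1) unfolding upper_entropy_def entropy_continuity_def
    by (meson one_le_numeral)
  have inc: "entropy_increasing H"
    using assms(1) by (simp add: upper_entropy_def)
  have "0 \<le> H ?split - H p \<and>
      H ?split - H p \<le> (if p ! k = 0 then 0 else p ! k * H (map (\<lambda>x. x / p ! k) [0, p ! k]))"
    by (rule inc[unfolded entropy_increasing_def, rule_format, of N p k 2])
      (use assms(2,3) k nonneg in auto)
  moreover have "(if p ! k = 0 then 0 else p ! k * H (map (\<lambda>x. x / p ! k) [0, p ! k])) = 0"
    using H01 by simp
  ultimately have "H p = H ?split"
    by linarith
  then show ?thesis
    by (simp only: split_eq k_def[symmetric])
qed

end
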